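(* Every infinite compact Hausdorff first-countable topological space $X$ contains a non-trivial convergent sequence: there exist a sequence $(a_n)_{n<\omega}$ of points of $X$ that is not eventually constant and a point $a\in X$ such that $a_n\to a$.
   Context: A neighbourhood base of $x\in X$ is a collection of neighbourhoods of $x$ such that every neighbourhood of $x$ contains a member of the collection. A space is first-countable if every point has a countable neighbourhood base. A sequence $(a_n)$ converges to $a$ if every open neighbourhood of $a$ contains all but finitely many terms of the sequence. A sequence is trivial if it is eventually constant, and non-trivial otherwise. *)

theory Defs
  imports "HOL-Analysis.Analysis"
begin

end

theory Submission
  imports Defs
begin

text \<open>By compactness, the infinite set of all points has an accumulation point
  \<open>l\<close>. First countability turns accumulation into sequential convergence: some sequence
  of points different from \<open>l\<close> tends to \<open>l\<close>. Such a sequence cannot be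
  eventually constant, since its eventual value would be a second limit, and limits in a Hausdorff
  space are unique.\<close>

text \<open>Shrinking basic neighbourhoods of \<open>l\<close> each contain a point of
  \<open>S\<close> other than \<open>l\<close>; choosing one from each gives the sequence. Keeping
  the terms away from \<open>l\<close> is what later rules out triviality.\<close>

lemma first_countable_derived_set_of_sequentially:
  assumes "first_countable X" and l: "l \<in> X derived_set_of S"
  obtains a :: "nat \<Rightarrow> 'a" where "range a \<subseteq> S - {l}" "limitin X a l sequentially"
proof -
  have lX: "l \<in> topspace X"
    using l by (simp add: in_derived_set_of)
  then obtain \<B> where "countable \<B>" and op: "\<forall>V\<in>\<B>. openin X V"
    and base: "\<forall>U. openin X U \<and> l \<in> U \<longrightarrow> (\<exists>V\<in>\<B>. l \<in> V \<and> V \<subseteq> U)"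
    using assms(1) unfolding first_countable_def by auto
  \<comment> \<open>Members of \<open>\<B>\<close> may miss \<open>l\<close>; they are discarded so
    that finite intersections remain neighbourhoods of \<open>l\<close>.\<close>
  define \<C> where "\<C> = {V \<in> \<B>. l \<in> V}"
  have "countable \<C>"
    using \<open>countable \<B>\<close> by (simp add: \<C>_def)
  moreover have "\<C> \<noteq> {}"
    using base lX openin_topspace[of X] by (fastforce simp: \<C>_def)
  \<comment> \<open>The enumeration may repeat sets, so a finite \<open>\<C>\<close> is covered as
    well.\<close>
  ultimately obtain B :: "nat \<Rightarrow> 'a set" where B: "\<C> = range B"
    using range_from_nat_into by metis
  have opB: "openin X (B k)" and lB: "l \<in> B k" for k
  proof -
    have "B k \<in> \<C>"
      by (simp add: B)
    then show "openin X (B k)" "l \<in> B k"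
      using op by (simp_all add: \<C>_def)
  qed
  \<comment> \<open>Intersecting the first sets makes the neighbourhoods decrease, so that
    \<open>B k\<close> will contain every term from index \<open>k\<close> on.\<close>
  have "\<exists>y. y \<noteq> l \<and> y \<in> S \<and> y \<in> (\<Inter>k\<le>n. B k)" for n
  proof -
    have "openin X (\<Inter>k\<le>n. B k)" "l \<in> (\<Inter>k\<le>n. B k)"
      using opB lB by (simp_all add: openin_INT2)
    then show ?thesis
      using l unfolding in_derived_set_of by blast
  qed
  then obtain a where a: "\<And>n. a n \<noteq> l" "\<And>n. a n \<in> S" "\<And>n. a n \<in> (\<Inter>k\<le>n. B k)"
    by metis
  have "limitin X a l sequentially"
    unfolding limitin_def
  proof (intro conjI allI impI lX)
    fix U assume "openin X U \<and> l \<in> U"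
    then obtain V where "V \<in> \<C>" "V \<subseteq> U"
      using base by (auto simp: \<C>_def)
    then obtain k where "B k \<subseteq> U"
      using B by auto
    then have "a n \<in> U" if "n \<ge> k" for n
      using a(3)[of n] that by auto
    then show "\<forall>\<^sub>F n in sequentially. a n \<in> U"
      unfolding eventually_sequentially by blast
  qed
  moreover have "range a \<subseteq> S - {l}"
    using a(1,2) by auto
  ultimately show thesis
    by (rule that[rotated])
qed

theorem theorem2p4p5:
  fixes X :: "'a topology"
  assumes "infinite (topspace X)"
    and "compact_space X"
    and "Hausdorff_space X"
    and "first_countable X"
  shows "\<exists>(a :: nat \<Rightarrow> 'a) l.
           (\<forall>n. a n \<in> topspace X) \<and> l \<in> topspace X \<and>
           \<not> (\<exists>c. \<forall>\<^sub>F n in sequentially. a n = c) \<and>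
           limitin X a l sequentially"
proof -
  obtain l where l: "l \<in> X derived_set_of topspace X"
    using compact_space_imp_Bolzano_Weierstrass[OF assms(2,1)] by blast
  obtain a where a: "range a \<subseteq> topspace X - {l}" and lim: "limitin X a l sequentially"
    using first_countable_derived_set_of_sequentially[OF assms(4) l] by metis
  have "\<not> (\<forall>\<^sub>F n in sequentially. a n = c)" for c
  proof
    assume ev: "\<forall>\<^sub>F n in sequentially. a n = c"
    then obtain n where "a n = c"
      using eventually_happens'[OF sequentially_bot] by blast
    then have c: "c \<in> topspace X" "c \<noteq> l"
      using a by auto
    \<comment> \<open>An eventually constant sequence converges to its eventual value, here a point
      of the space other than \<open>l\<close>.\<close>
    have "limitin X a c sequentially"
      using c(1) ev by (auto simp: limitin_def elim: eventually_mono)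
    then show False
      using limitin_Hausdorff_unique[OF lim _ sequentially_bot assms(3)] c(2) by blast
  qed
  then show ?thesis
    using a lim limitin_topspace[OF lim] by blast
qed

end
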